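(* Let $g_0:\mathbb{R}^n\to\overline{\mathbb{R}}$ be proper and lsc, let $H_i:\mathbb{R}^n\rightrightarrows\Xi$ be osc and $b_i\in[0,1]$ for $i=1,\dots,m$, let $\mu,\mu^\nu\in\mathscr{P}(\Xi)$, and let $\phi(x)=g_0(x)+\sum_{i=1}^m\iota_{(-\infty,0]}\big(b_i-\mu(H_i(x))\big)$ with $\operatorname{argmin}\phi\ne\emptyset$. Suppose $d_{\rm mi}(\mu^\nu,\mu)\to0$, let $\alpha\ge1$, and let $\lambda^\nu\in(0,\infty)\to0$ satisfy $\tfrac1{\lambda^\nu}d_{\rm mi}(\mu^\nu,\mu)^\alpha\to0$. Define $$f^\nu(u,x)=g_0(x)+\sum_{i=1}^m\iota_{(-\infty,0]}\big(u_i+b_i-\mu^\nu(H_i(x))\big)+\tfrac1{\alpha\lambda^\nu}\|u\|_2^\alpha,\qquad (u,x)\in\mathbb{R}^m\times\mathbb{R}^n .$$ If the sequence $\{(u^\nu,x^\nu)\}_\nu$ is bounded with $(u^\nu,x^\nu)\in\epsilon^\nu\text{-}\operatorname{argmin}f^\nu$ for all $\nu$, where $\epsilon^\nu\in[0,\infty)\to0$, then: (a) $f^\nu(u^\nu,x^\nu)\to\inf\phi$; (b) $\operatorname{LimOut}(\epsilon^\nu\text{-}\operatorname{argmin}f^\nu)\subseteq\{0\}\times\operatorname{argmin}\phi$; in particular, every cluster point of $\{x^\nu\}_\nu$ belongs to $\operatorname{argmin}\phi$.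
   Context: $\Xi\subseteq\mathbb{R}^d$ is nonempty and closed; $\mathscr{P}(\Xi)$ is the set of Borel probability measures on $\Xi$; $\overline{\mathbb{R}}=[-\infty,\infty]$; lsc = lower semicontinuous; proper = never $-\infty$ and not identically $\infty$. $\iota_C=0$ on $C$, $\infty$ off $C$. $H:\mathbb{R}^n\rightrightarrows\Xi$ is osc (outer semicontinuous) if $x^\nu\to x$, $\xi^\nu\in H(x^\nu)$ and $\xi$ a cluster point of $\{\xi^\nu\}$ imply $\xi\in H(x)$ (equivalently, closed graph). $d_{\rm mi}(\mu_1,\mu_2)=\sup_{x\in\operatorname{dom}g_0}\max_{1\le i\le m}|\mu_1(H_i(x))-\mu_2(H_i(x))|$. For $\psi:\mathbb{R}^k\to\overline{\mathbb{R}}$: $\operatorname{dom}\psi=\{\psi<\infty\}$, $\operatorname{argmin}\psi=\{z\in\operatorname{dom}\psi:\psi(z)=\inf\psi\}$, $\epsilon\text{-}\operatorname{argmin}\psi=\{z\in\operatorname{dom}\psi:\psi(z)\le\inf\psi+\epsilon\}$. For sets $C^\nu\subseteq\mathbb{R}^k$, $\operatorname{LimOut}C^\nu$ is the set of limits of sequences $z^\nu\in C^\nu$, $\nu\in N$, over infinite $N\subseteq\mathbb{N}$. *)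

theory Defs
  imports "HOL-Probability.Probability"
begin

section \<open>Extended-real-valued functions\<close>

definition eff_dom :: "('a \<Rightarrow> ereal) \<Rightarrow> 'a set" where
  "eff_dom f = {z. f z < \<infinity>}"

definition proper :: "('a \<Rightarrow> ereal) \<Rightarrow> bool" where
  "proper f \<longleftrightarrow> (\<forall>z. f z \<noteq> -\<infinity>) \<and> (\<exists>z. f z \<noteq> \<infinity>)"

text \<open>The filter is \<^term>\<open>nhds z\<close>, not \<^term>\<open>at z\<close>, so the lower limit takes the value at
  \<open>z\<close> itself into account, as is usual in variational analysis.\<close>

definition lsc :: "('a::topological_space \<Rightarrow> ereal) \<Rightarrow> bool" where
  "lsc f \<longleftrightarrow> (\<forall>z. f z \<le> Liminf (nhds z) f)"

definition ind :: "'a set \<Rightarrow> 'a \<Rightarrow> ereal"  (\<open>\<iota>\<close>) where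
  "\<iota> C z = (if z \<in> C then 0 else \<infinity>)"

definition argmin :: "('a \<Rightarrow> ereal) \<Rightarrow> 'a set" where
  "argmin f = {z \<in> eff_dom f. f z = (INF y. f y)}"

definition eps_argmin :: "real \<Rightarrow> ('a \<Rightarrow> ereal) \<Rightarrow> 'a set" where
  "eps_argmin \<epsilon> f = {z \<in> eff_dom f. f z \<le> (INF y. f y) + ereal \<epsilon>}"

section \<open>Cluster points, outer limits and outer semicontinuity\<close>

text \<open>Infinite subsets of the index set are given by their strictly increasing enumerations \<open>r\<close>.\<close>

definition cluster_point :: "(nat \<Rightarrow> 'a::topological_space) \<Rightarrow> 'a \<Rightarrow> bool" where
  "cluster_point X z \<longleftrightarrow> (\<exists>r. strict_mono r \<and> (X \<circ> r) \<longlonglongrightarrow> z)"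

definition LimOut :: "(nat \<Rightarrow> 'a::topological_space set) \<Rightarrow> 'a set" where
  "LimOut C = {z. \<exists>r w. strict_mono r \<and> (\<forall>k. w k \<in> C (r k)) \<and> w \<longlonglongrightarrow> z}"

definition osc :: "('a::topological_space \<Rightarrow> 'b::topological_space set) \<Rightarrow> bool" where
  "osc F \<longleftrightarrow> (\<forall>X x Y y. X \<longlonglongrightarrow> x \<longrightarrow> (\<forall>\<nu>. Y \<nu> \<in> F (X \<nu>)) \<longrightarrow> cluster_point Y y \<longrightarrow> y \<in> F x)"

section \<open>Probability constraints\<close>

definition borel_probs :: "'a::topological_space set \<Rightarrow> 'a measure set" where
  "borel_probs \<Xi> = {M. prob_space M \<and> sets M = sets (restrict_space borel \<Xi>)}"

text \<open>The supremum is taken over the reals: all terms lie in \<open>[0, 1]\<close> for probability measures, and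
  \<^term>\<open>eff_dom g\<^sub>0\<close> is nonempty whenever \<open>g\<^sub>0\<close> is proper.\<close>

definition d_mi ::
  "('x \<Rightarrow> ereal) \<Rightarrow> ('m::finite \<Rightarrow> 'x \<Rightarrow> 'a set) \<Rightarrow> 'a measure \<Rightarrow> 'a measure \<Rightarrow> real" where
  "d_mi g\<^sub>0 H \<mu>\<^sub>1 \<mu>\<^sub>2 = (SUP x\<in>eff_dom g\<^sub>0. MAX i. \<bar>measure \<mu>\<^sub>1 (H i x) - measure \<mu>\<^sub>2 (H i x)\<bar>)"

definition constrained_obj ::
  "('x \<Rightarrow> ereal) \<Rightarrow> ('m::finite \<Rightarrow> 'x \<Rightarrow> 'a set) \<Rightarrow> ('m \<Rightarrow> real) \<Rightarrow> 'a measure \<Rightarrow> 'x \<Rightarrow> ereal" where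
  "constrained_obj g\<^sub>0 H b \<mu> x = g\<^sub>0 x + (\<Sum>i\<in>UNIV. \<iota> {..0} (b i - measure \<mu> (H i x)))"

definition relaxed_obj ::
  "('x \<Rightarrow> ereal) \<Rightarrow> ('m::finite \<Rightarrow> 'x \<Rightarrow> 'a set) \<Rightarrow> ('m \<Rightarrow> real) \<Rightarrow> real \<Rightarrow> real \<Rightarrow> 'a measure
    \<Rightarrow> (real ^ 'm) \<times> 'x \<Rightarrow> ereal" where
  "relaxed_obj g\<^sub>0 H b \<alpha> \<kappa> M = (\<lambda>(u, x).
     g\<^sub>0 x + (\<Sum>i\<in>UNIV. \<iota> {..0} (u $ i + b i - measure M (H i x)))
       + ereal (1 / (\<alpha> * \<kappa>) * norm u powr \<alpha>))"

end

theory Submission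
  imports Defs
begin

text \<open>The point \<open>(-d\<^sub>\<nu>, \<dots>, -d\<^sub>\<nu>)\<close> with \<open>d\<^sub>\<nu>\<close> the distance of the measures makes any minimizer of
  \<open>\<phi>\<close> feasible for the relaxed problem, at a penalty of order \<open>d\<^sub>\<nu>\<^sup>\<alpha> / \<lambda>\<^sub>\<nu> \<rightarrow> 0\<close>; hence near-minimal
  values are asymptotically at most \<open>inf \<phi>\<close>. Along a convergent sequence of near-minimizers, lower
  semicontinuity of \<open>g\<^sub>0\<close> then bounds the penalty term, which forces \<open>u \<rightarrow> 0\<close>, and the limit is feasible
  because outer semicontinuity of \<open>H\<^sub>i\<close> makes \<open>x \<mapsto> \<mu>(H\<^sub>i(x))\<close> upper semicontinuous. So the limit
  minimizes \<open>\<phi>\<close> and the values converge to \<open>inf \<phi>\<close>.\<close>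

section \<open>Explicit form of the two objectives\<close>

lemma sum_ind_atMost:
  "(\<Sum>i\<in>UNIV. \<iota> {..0} (c i)) = (if \<forall>i::'m::finite. c i \<le> (0::real) then 0 else \<infinity>)"
proof (cases "\<forall>i. c i \<le> 0")
  case True
  then show ?thesis by (simp add: ind_def)
next
  case False
  then obtain i where "\<iota> {..0} (c i) = \<infinity>" by (auto simp: ind_def)
  then have "(\<Sum>i\<in>UNIV. \<iota> {..0} (c i)) = \<infinity>" by (subst sum_Pinfty) auto
  with False show ?thesis by simp
qed

lemma constrained_obj_eq:
  assumes "proper g"
  shows "constrained_obj g H b M x = (if \<forall>i. b i \<le> measure M (H i x) then g x else \<infinity>)"
  using assms by (simp add: constrained_obj_def sum_ind_atMost proper_def)

lemma relaxed_obj_eq: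
  assumes "proper g"
  shows "relaxed_obj g H b \<alpha> k M (u, x) =
    (if \<forall>i. u $ i + b i \<le> measure M (H i x)
     then g x + ereal (1 / (\<alpha> * k) * norm u powr \<alpha>) else \<infinity>)"
  using assms by (simp add: relaxed_obj_def sum_ind_atMost proper_def)

section \<open>Semicontinuity of functions, set-valued maps and measures\<close>

lemma eventually_less_lsc:
  assumes "lsc g" "X \<longlonglongrightarrow> x" "c < g x"
  shows "\<forall>\<^sub>F k in sequentially. c < g (X k)"
proof -
  have "c < Liminf (nhds x) g" using assms(1,3) unfolding lsc_def by (meson less_le_trans)
  then have "\<forall>\<^sub>F y in nhds x. c < g y" by (rule less_LiminfD)
  then show ?thesis using assms(2) by (auto simp: filterlim_iff)
qed

text \<open>The indices \<open>k\<close> with \<open>y \<in> F (X k)\<close> enumerate a subsequence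
  of \<open>X\<close>; outer semicontinuity is applied along it to the constant sequence
  \<open>y\<close>.\<close>

lemma osc_frequently_mem:
  assumes "osc F" "X \<longlonglongrightarrow> x" "\<exists>\<^sub>F k in sequentially. y \<in> F (X k)"
  shows "y \<in> F x"
proof -
  have inf: "infinite {k. y \<in> F (X k)}"
    using assms(3) by (simp add: cofinite_eq_sequentially[symmetric] frequently_cofinite)
  define r where "r = enumerate {k. y \<in> F (X k)}"
  have r: "strict_mono r" and "y \<in> F ((X \<circ> r) k)" for k
    using inf strict_mono_enumerate enumerate_in_set[OF inf] by (auto simp: r_def)
  moreover have "(X \<circ> r) \<longlonglongrightarrow> x" using assms(2) r by (rule LIMSEQ_subseq_LIMSEQ)
  moreover have "cluster_point (\<lambda>_. y) y"
    unfolding cluster_point_def by (rule exI[of _ id]) (auto simp: strict_mono_def)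
  ultimately show ?thesis using assms(1) unfolding osc_def by meson
qed

text \<open>Outer semicontinuity along a constant sequence of base points; this is what makes the
  values measurable in \<open>osc_sets\<close>.\<close>

lemma closed_osc:
  fixes F :: "'a::topological_space \<Rightarrow> 'b::first_countable_topology set"
  assumes "osc F"
  shows "closed (F x)"
  unfolding closed_sequential_limits
proof safe
  fix Y y assume "\<forall>n. Y n \<in> F x" "Y \<longlonglongrightarrow> y"
  moreover from this have "cluster_point Y y"
    unfolding cluster_point_def by (intro exI[of _ id]) (auto simp: strict_mono_def)
  ultimately show "y \<in> F x"
    using assms unfolding osc_def by (metis tendsto_const)
qed

lemma osc_sets:
  fixes F :: "'a::topological_space \<Rightarrow> 'b::first_countable_topology set"
  assumes "osc F" "M \<in> borel_probs \<Xi>" "F x \<subseteq> \<Xi>"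
  shows "F x \<in> sets M"
proof -
  have "F x = \<Xi> \<inter> F x" using assms(3) by auto
  moreover have "F x \<in> sets borel" using assms(1) by (intro borel_closed closed_osc)
  ultimately show ?thesis using assms(2) by (auto simp: borel_probs_def sets_restrict_space)
qed

text \<open>Continuity from above along the tail unions \<open>B n\<close>: a point in all of them
  lies in \<open>F (X k)\<close> for infinitely many \<open>k\<close>, hence in \<open>F x\<close>,
  while each \<open>B n\<close> contains \<open>F (X n)\<close>.\<close>

lemma osc_measure_usc:
  assumes "finite_measure M" "osc F" "\<And>y. F y \<in> sets M" "X \<longlonglongrightarrow> x"
    and "\<And>k. a k \<le> measure M (F (X k))" "a \<longlonglongrightarrow> l"
  shows "l \<le> measure M (F x)"
proof -
  interpret finite_measure M by fact
  define B where "B n = (\<Union>k\<in>{n..}. F (X k))" for n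
  have B: "B n \<in> sets M" for n using assms(3) by (auto simp: B_def)
  have "decseq B" by (force simp: B_def decseq_def)
  then have "(\<lambda>n. measure M (B n)) \<longlonglongrightarrow> measure M (\<Inter>n. B n)"
    using B by (intro finite_Lim_measure_decseq) auto
  moreover have "a n \<le> measure M (B n)" for n
    using assms(5)[of n] finite_measure_mono[of "F (X n)" "B n"] B by (fastforce simp: B_def)
  ultimately have "l \<le> measure M (\<Inter>n. B n)" using assms(6) by (auto intro: LIMSEQ_le)
  also have "\<dots> \<le> measure M (F x)"
  proof (rule finite_measure_mono)
    show "(\<Inter>n. B n) \<subseteq> F x"
      using osc_frequently_mem[OF assms(2,4)] by (fastforce simp: B_def frequently_sequentially)
  qed (fact assms)
  finally show ?thesis .
qed

section \<open>Effect of replacing one measure by another\<close>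

text \<open>A supremum over the reals dominates its terms only if these are bounded above;
  probability measures give the bound 1.\<close>

lemma d_mi_ge:
  assumes "M \<in> borel_probs \<Xi>" "N \<in> borel_probs \<Xi>" "x \<in> eff_dom g"
  shows "\<bar>measure M (H i x) - measure N (H i x)\<bar> \<le> d_mi g H M N"
proof -
  interpret M: prob_space M using assms by (simp add: borel_probs_def)
  interpret N: prob_space N using assms by (simp add: borel_probs_def)
  let ?t = "\<lambda>x. MAX i. \<bar>measure M (H i x) - measure N (H i x)\<bar>"
  have "\<bar>measure M A - measure N A\<bar> \<le> 1" for A
    using M.prob_le_1[of A] N.prob_le_1[of A] measure_nonneg[of M A] measure_nonneg[of N A]
    by linarith
  then have "?t y \<le> 1" for y by (simp add: Max_le_iff)
  then have "bdd_above (?t ` eff_dom g)" by (intro bdd_aboveI2)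
  then have "?t x \<le> d_mi g H M N" unfolding d_mi_def using assms(3) by (rule cSUP_upper2) simp
  moreover have "\<bar>measure M (H i x) - measure N (H i x)\<bar> \<le> ?t x" by (rule Max_ge) auto
  ultimately show ?thesis by linarith
qed

text \<open>Passing from \<open>N\<close> to \<open>M\<close> loses at most
  \<open>d_mi g H M N\<close> in each constraint, and a shift of \<open>u\<close> by that amount
  absorbs the loss.\<close>

lemma INF_relaxed_obj_le:
  fixes H :: "'m::finite \<Rightarrow> 'x \<Rightarrow> 'a::topological_space set"
  assumes "proper g" "M \<in> borel_probs \<Xi>" "N \<in> borel_probs \<Xi>"
    and "x \<in> argmin (constrained_obj g H b N)"
  shows "(INF z. relaxed_obj g H b \<alpha> k M z) \<le> (INF y. constrained_obj g H b N y)
    + ereal (1 / (\<alpha> * k) * (d_mi g H M N * norm (1 :: real ^ 'm)) powr \<alpha>)"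
proof -
  let ?d = "d_mi g H M N"
  \<comment> \<open>Here \<open>1\<close> is the all-ones vector, so every component of
    \<open>?u\<close> is \<open>- ?d\<close>; its norm, the square root of the number of
    constraints, stays in the bound as a constant.\<close>
  let ?u = "- ?d *\<^sub>R (1 :: real ^ 'm)"
  have \<phi>x: "constrained_obj g H b N x = (INF y. constrained_obj g H b N y)"
    and fin: "constrained_obj g H b N x < \<infinity>"
    using assms(4) by (auto simp: argmin_def eff_dom_def)
  then have feas: "\<forall>i. b i \<le> measure N (H i x)" and gx: "constrained_obj g H b N x = g x"
    using assms(1) by (auto simp: constrained_obj_eq split: if_splits)
  have x: "x \<in> eff_dom g" using fin gx by (simp add: eff_dom_def)
  note d = d_mi_ge[OF assms(2,3) x, of H]
  have "0 \<le> ?d" using order_trans[OF abs_ge_zero d] .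
  then have "norm ?u = ?d * norm (1 :: real ^ 'm)" by simp
  moreover have "?u $ i + b i \<le> measure M (H i x)" for i
    using feas[rule_format, of i] d[of i] by simp
  ultimately have "relaxed_obj g H b \<alpha> k M (?u, x) =
      g x + ereal (1 / (\<alpha> * k) * (?d * norm (1 :: real ^ 'm)) powr \<alpha>)"
    using assms(1) by (simp only: relaxed_obj_eq) simp
  then show ?thesis using gx \<phi>x by (metis INF_lower UNIV_I)
qed

section \<open>Limits of convergent sequences of near-minimizers\<close>

text \<open>The hypotheses on the data are inherited by subsequences, so this can be applied along
  any strictly increasing choice of indices.\<close>

lemma eps_argmin_convergent:
  fixes H :: "'m::finite \<Rightarrow> 'x::topological_space \<Rightarrow> 'a::first_countable_topology set"
    and u :: "nat \<Rightarrow> real ^ 'm"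
  assumes g: "proper g" "lsc g"
    and H: "\<And>i y. H i y \<subseteq> \<Xi>" "\<And>i. osc (H i)"
    and \<mu>: "\<mu> \<in> borel_probs \<Xi>" "\<And>k. \<mu>s k \<in> borel_probs \<Xi>"
    and ne: "argmin (constrained_obj g H b \<mu>) \<noteq> {}"
    and d: "(\<lambda>k. d_mi g H (\<mu>s k) \<mu>) \<longlonglongrightarrow> 0"
    and \<alpha>: "\<alpha> \<ge> 1"
    and \<kappa>: "\<And>k. \<kappa> k > 0" "\<kappa> \<longlonglongrightarrow> 0"
    and d\<kappa>: "(\<lambda>k. 1 / \<kappa> k * d_mi g H (\<mu>s k) \<mu> powr \<alpha>) \<longlonglongrightarrow> 0"
    and \<epsilon>: "\<epsilon>s \<longlonglongrightarrow> 0"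
    and mem: "\<And>k. (u k, x k) \<in> eps_argmin (\<epsilon>s k) (relaxed_obj g H b \<alpha> (\<kappa> k) (\<mu>s k))"
    and lim: "u \<longlonglongrightarrow> u'" "x \<longlonglongrightarrow> x'"
  shows "u' = 0" and "x' \<in> argmin (constrained_obj g H b \<mu>)"
    and "(\<lambda>k. relaxed_obj g H b \<alpha> (\<kappa> k) (\<mu>s k) (u k, x k))
      \<longlonglongrightarrow> (INF y. constrained_obj g H b \<mu> y)"
proof -
  let ?\<phi> = "constrained_obj g H b \<mu>"
  let ?f = "\<lambda>k. relaxed_obj g H b \<alpha> (\<kappa> k) (\<mu>s k)"
  define d where "d k = d_mi g H (\<mu>s k) \<mu>" for k
  define p where "p k = 1 / (\<alpha> * \<kappa> k) * norm (u k) powr \<alpha>" for k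
  \<comment> \<open>The penalty of the shifted minimizer plus the tolerance: the excess over the
    infimum of \<open>?\<phi>\<close> that a near-minimizer may have.\<close>
  define s where "s k = 1 / (\<alpha> * \<kappa> k) * (d k * norm (1 :: real ^ 'm)) powr \<alpha> + \<epsilon>s k" for k
  obtain z where z: "z \<in> argmin ?\<phi>" using ne by auto
  \<comment> \<open>The infimum is real: it is attained at a value below \<infinity>, and
    \<open>g\<close> never equals -\<infinity>.\<close>
  obtain v where v: "(INF y. ?\<phi> y) = ereal v"
    using z g(1) by (cases "g z")
      (auto simp: argmin_def eff_dom_def constrained_obj_eq proper_def split: if_splits)
  have feas: "u k $ i + b i \<le> measure (\<mu>s k) (H i (x k))"
    and fk: "?f k (u k, x k) = g (x k) + ereal (p k)"
    and dom: "x k \<in> eff_dom g" for k i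
    using mem[of k] g(1)
    by (auto simp: eps_argmin_def eff_dom_def relaxed_obj_eq p_def split: if_splits)
  have p0: "0 \<le> p k" for k using \<alpha> \<kappa>(1)[of k] by (simp add: p_def)
  have dge: "\<bar>measure (\<mu>s k) (H i (x k)) - measure \<mu> (H i (x k))\<bar> \<le> d k" for k i
    unfolding d_def using \<mu> dom by (intro d_mi_ge)
  have d0: "0 \<le> d k" for k using order_trans[OF abs_ge_zero dge] .
  have s: "s \<longlonglongrightarrow> 0"
  proof -
    \<comment> \<open>Splitting off the constant factor leaves exactly the quotient controlled by
      \<open>d\<kappa>\<close>.\<close>
    have "(\<lambda>k. norm (1 :: real ^ 'm) powr \<alpha> / \<alpha> * (1 / \<kappa> k * d k powr \<alpha>) + \<epsilon>s k) \<longlonglongrightarrow> 0"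
      unfolding d_def
      using tendsto_add[OF tendsto_mult_right_zero[OF d\<kappa>] \<epsilon>] by (simp only: add_0)
    moreover have "s k = norm (1 :: real ^ 'm) powr \<alpha> / \<alpha> * (1 / \<kappa> k * d k powr \<alpha>) + \<epsilon>s k" for k
      using d0[of k] by (simp add: s_def powr_mult)
    ultimately show ?thesis by presburger
  qed
  have up: "g (x k) + ereal (p k) \<le> ereal (v + s k)" for k
  proof -
    have "?f k (u k, x k) \<le> (INF z. ?f k z) + ereal (\<epsilon>s k)"
      using mem[of k] by (simp add: eps_argmin_def)
    also have "\<dots> \<le> (ereal v + ereal (s k - \<epsilon>s k)) + ereal (\<epsilon>s k)"
      using INF_relaxed_obj_le[OF g(1) \<mu>(2)[of k] \<mu>(1) z, of \<alpha> "\<kappa> k"]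
      by (intro add_right_mono) (simp add: v s_def d_def)
    finally show ?thesis by (simp add: fk)
  qed
  \<comment> \<open>At this stage \<open>g x'\<close> could be \<infinity>, so it is compared with
    \<open>v\<close> through the reals \<open>c\<close> below it; the nonnegative penalty is
    dropped.\<close>
  have le: "c \<le> v" if c: "ereal c < g x'" for c
  proof -
    have "\<forall>\<^sub>F k in sequentially. c \<le> v + s k"
      using eventually_less_lsc[OF g(2) lim(2) c]
    proof eventually_elim
      case (elim k)
      have "ereal c \<le> g (x k) + ereal (p k)"
        using elim p0[of k] by (cases "g (x k)") auto
      with up[of k] have "ereal c \<le> ereal (v + s k)" by (rule order_trans[rotated])
      then show ?case by simp
    qed
    moreover have "(\<lambda>k. v + s k) \<longlonglongrightarrow> v" using tendsto_add[OF tendsto_const s, of v] by simp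
    ultimately show ?thesis by (intro tendsto_lowerbound) auto
  qed
  have g_le: "g x' \<le> ereal v"
  proof (rule ccontr)
    assume "\<not> g x' \<le> ereal v"
    then obtain c where "v < c" "ereal c < g x'" using ereal_dense2[of "ereal v" "g x'"] by (auto simp: not_le)
    with le[of c] show False by simp
  qed

  have "u \<longlonglongrightarrow> 0"
  proof -
    \<comment> \<open>Such a \<open>c\<close> exists because \<open>g x'\<close> is not
      -\<infinity>. Eventually \<open>c < g (x k)\<close>, so \<open>up\<close> bounds the penalty
      by \<open>v + s k - c\<close>; multiplied by \<open>\<alpha> * \<kappa> k\<close>, this bound
      tends to 0.\<close>
    obtain c where c: "ereal c < g x'"
      using g(1) ereal_dense2[of "-\<infinity>" "g x'"] by (auto simp: proper_def)
    have ev: "\<forall>\<^sub>F k in sequentially. norm (u k) powr \<alpha> \<le> \<alpha> * \<kappa> k * (v + s k - c)"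
      using eventually_less_lsc[OF g(2) lim(2) c]
    proof eventually_elim
      case (elim k)
      have "p k \<le> v + s k - c" using elim up[of k] by (cases "g (x k)") auto
      then have "\<alpha> * \<kappa> k * p k \<le> \<alpha> * \<kappa> k * (v + s k - c)"
        using \<alpha> \<kappa>(1)[of k] by (intro mult_left_mono) auto
      moreover have "\<alpha> * \<kappa> k * p k = norm (u k) powr \<alpha>"
        using \<alpha> \<kappa>(1)[of k] by (simp add: p_def)
      ultimately show ?case by simp
    qed
    have "(\<lambda>k. \<alpha> * \<kappa> k * (v + s k - c)) \<longlonglongrightarrow> \<alpha> * 0 * (v + 0 - c)"
      by (intro tendsto_intros \<kappa> s)
    then have "(\<lambda>k. norm (u k) powr \<alpha>) \<longlonglongrightarrow> 0"
      by (intro tendsto_sandwich[OF _ ev tendsto_const]) auto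
    then have "(\<lambda>k. (norm (u k) powr \<alpha>) powr (1 / \<alpha>)) \<longlonglongrightarrow> 0"
      using \<alpha>
      by (intro tendsto_zero_powrI[where b = "1 / \<alpha>" and f = "\<lambda>k. norm (u k) powr \<alpha>"]) auto
    then have "(\<lambda>k. norm (u k)) \<longlonglongrightarrow> 0" using \<alpha> by (simp add: powr_powr)
    then show ?thesis by (rule tendsto_norm_zero_cancel)
  qed
  then show "u' = 0" using lim(1) LIMSEQ_unique by blast

  \<comment> \<open>Feasibility for the varying measures is transferred to the fixed
    \<open>\<mu>\<close> at the cost \<open>d k\<close>; the resulting lower bounds tend to
    \<open>b i\<close>.\<close>
  have "b i \<le> measure \<mu> (H i x')" for i
  proof (rule osc_measure_usc[OF _ H(2)[of i] _ lim(2)])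
    show "finite_measure \<mu>" using \<mu>(1) by (simp add: borel_probs_def prob_space.finite_measure)
    show "H i y \<in> sets \<mu>" for y using H \<mu>(1) by (intro osc_sets)
    show "u k $ i + b i - d k \<le> measure \<mu> (H i (x k))" for k
      using feas[of k i] dge[of k i] by linarith
    have "(\<lambda>k. u k $ i + b i - d k) \<longlonglongrightarrow> 0 $ i + b i - 0"
      using d by (intro tendsto_intros \<open>u \<longlonglongrightarrow> 0\<close>) (simp add: d_def)
    then show "(\<lambda>k. u k $ i + b i - d k) \<longlonglongrightarrow> b i" by simp
  qed
  then have \<phi>x': "?\<phi> x' = g x'" using g(1) by (simp add: constrained_obj_eq)
  \<comment> \<open>Feasibility of \<open>x'\<close> supplies the reverse inequality, since
    \<open>v\<close> is the infimum of \<open>?\<phi>\<close>.\<close>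
  have gx': "g x' = ereal v"
    using g_le INF_lower[of x' UNIV ?\<phi>] by (simp add: v \<phi>x')
  show "x' \<in> argmin ?\<phi>" by (simp add: argmin_def eff_dom_def \<phi>x' v gx')

  \<comment> \<open>From below: lower semicontinuity at \<open>x'\<close>, where
    \<open>g x' = v\<close>, and \<open>p k \<ge> 0\<close>. From above: \<open>up\<close> with
    \<open>s\<close> tending to 0.\<close>
  show "(\<lambda>k. ?f k (u k, x k)) \<longlonglongrightarrow> (INF y. ?\<phi> y)"
    unfolding v fk
  proof (rule order_tendstoI)
    fix c assume "c < ereal v"
    then have "\<forall>\<^sub>F k in sequentially. c < g (x k)"
      by (intro eventually_less_lsc[OF g(2) lim(2)]) (simp add: gx')
    then show "\<forall>\<^sub>F k in sequentially. c < g (x k) + ereal (p k)"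
    proof eventually_elim
      case (elim k)
      also have "g (x k) \<le> g (x k) + ereal (p k)" using p0[of k] by (cases "g (x k)") auto
      finally show ?case .
    qed
  next
    fix c assume c: "ereal v < c"
    have "(\<lambda>k. ereal (v + s k)) \<longlonglongrightarrow> ereal v"
      using tendsto_add[OF tendsto_const s, of v] by (simp add: tendsto_ereal)
    then have "\<forall>\<^sub>F k in sequentially. ereal (v + s k) < c" using c by (rule order_tendstoD)
    then show "\<forall>\<^sub>F k in sequentially. g (x k) + ereal (p k) < c"
      by eventually_elim (use up in \<open>blast intro: le_less_trans\<close>)
  qed
qed

section \<open>From convergent subsequences to the bounded sequence\<close>

text \<open>If \<open>F\<close> left a neighbourhood \<open>S\<close> of \<open>l\<close> infinitely
  often, those indices would give a subsequence staying outside \<open>S\<close>, none of whose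
  subsequences could tend to \<open>l\<close>.\<close>

lemma tendsto_if_subseq_tendsto:
  fixes F :: "nat \<Rightarrow> 'a::topological_space"
  assumes "\<And>r :: nat \<Rightarrow> nat. strict_mono r \<Longrightarrow> \<exists>q. strict_mono q \<and> (F \<circ> (r \<circ> q)) \<longlonglongrightarrow> l"
  shows "F \<longlonglongrightarrow> l"
proof (rule topological_tendstoI, rule ccontr)
  fix S assume S: "open S" "l \<in> S" and "\<not> (\<forall>\<^sub>F n in sequentially. F n \<in> S)"
  then have inf: "infinite {n. F n \<notin> S}"
    by (simp add: cofinite_eq_sequentially[symmetric] eventually_cofinite)
  define r where "r = enumerate {n. F n \<notin> S}"
  have "strict_mono r" and r: "F (r k) \<notin> S" for k
    using inf strict_mono_enumerate enumerate_in_set[OF inf] by (auto simp: r_def)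
  then obtain q where "(F \<circ> (r \<circ> q)) \<longlonglongrightarrow> l" using assms by blast
  then have "\<forall>\<^sub>F k in sequentially. (F \<circ> (r \<circ> q)) k \<in> S" using S by (rule topological_tendstoD)
  then show False using r by (auto simp: eventually_sequentially)
qed

theorem corollary4p1:
  fixes \<Xi> :: "(real ^ 'd) set"
    and g\<^sub>0 :: "real ^ 'n \<Rightarrow> ereal"
    and H :: "'m::finite \<Rightarrow> real ^ 'n \<Rightarrow> (real ^ 'd) set"
    and b :: "'m \<Rightarrow> real"
    and \<mu> :: "(real ^ 'd) measure"
    and \<mu>s :: "nat \<Rightarrow> (real ^ 'd) measure"
    and \<alpha> :: real
    and \<kappa> \<epsilon>s :: "nat \<Rightarrow> real"
    and u :: "nat \<Rightarrow> real ^ 'm"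
    and x :: "nat \<Rightarrow> real ^ 'n"
  defines "\<phi> \<equiv> constrained_obj g\<^sub>0 H b \<mu>"
    and "f \<equiv> \<lambda>\<nu>. relaxed_obj g\<^sub>0 H b \<alpha> (\<kappa> \<nu>) (\<mu>s \<nu>)"
  assumes "closed \<Xi>" and "\<Xi> \<noteq> {}"
    and "proper g\<^sub>0" and "lsc g\<^sub>0"
    and "\<And>i y. H i y \<subseteq> \<Xi>" and "\<And>i. osc (H i)"
    and "\<And>i. b i \<in> {0..1}"
    and "\<mu> \<in> borel_probs \<Xi>" and "\<And>\<nu>. \<mu>s \<nu> \<in> borel_probs \<Xi>"
    and "argmin \<phi> \<noteq> {}"
    and "(\<lambda>\<nu>. d_mi g\<^sub>0 H (\<mu>s \<nu>) \<mu>) \<longlonglongrightarrow> 0"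
    and "\<alpha> \<ge> 1"
    and "\<And>\<nu>. \<kappa> \<nu> > 0" and "\<kappa> \<longlonglongrightarrow> 0"
    and "(\<lambda>\<nu>. 1 / \<kappa> \<nu> * d_mi g\<^sub>0 H (\<mu>s \<nu>) \<mu> powr \<alpha>) \<longlonglongrightarrow> 0"
    and "bounded (range (\<lambda>\<nu>. (u \<nu>, x \<nu>)))"
    and "\<And>\<nu>. \<epsilon>s \<nu> \<ge> 0" and "\<epsilon>s \<longlonglongrightarrow> 0"
    and "\<And>\<nu>. (u \<nu>, x \<nu>) \<in> eps_argmin (\<epsilon>s \<nu>) (f \<nu>)"
  shows "((\<lambda>\<nu>. f \<nu> (u \<nu>, x \<nu>)) \<longlonglongrightarrow> (INF y. \<phi> y)) \<and>
    LimOut (\<lambda>\<nu>. eps_argmin (\<epsilon>s \<nu>) (f \<nu>)) \<subseteq> {0} \<times> argmin \<phi> \<and>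
    (\<forall>z. cluster_point x z \<longrightarrow> z \<in> argmin \<phi>)"
proof -
  note [simp] = \<phi>_def f_def
  \<comment> \<open>The points \<open>w k\<close> are arbitrary near-minimizers at the indices
    \<open>r k\<close>, not only the given ones, as \<open>LimOut\<close> requires.\<close>
  have subseq: "u' = 0 \<and> x' \<in> argmin \<phi> \<and> (\<lambda>k. f (r k) (w k)) \<longlonglongrightarrow> (INF y. \<phi> y)"
    if r: "strict_mono r" and w: "\<And>k. w k \<in> eps_argmin (\<epsilon>s (r k)) (f (r k))"
      and lim: "w \<longlonglongrightarrow> (u', x')" for r w u' x'
  proof -
    note sub = LIMSEQ_subseq_LIMSEQ[OF _ r, unfolded o_def]
    have mem: "(fst (w k), snd (w k)) \<in>
      eps_argmin (\<epsilon>s (r k)) (relaxed_obj g\<^sub>0 H b \<alpha> (\<kappa> (r k)) (\<mu>s (r k)))" for k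
      using w[of k] by simp
    show ?thesis
      using eps_argmin_convergent[OF assms(5-8) assms(10) assms(11) _ sub[OF assms(13)] assms(14)
          assms(15) sub[OF assms(16)] sub[OF assms(17)] sub[OF assms(20)] mem
          tendsto_fst[OF lim] tendsto_snd[OF lim]] assms(12)
      by simp
  qed
  \<comment> \<open>Boundedness enters here, through Bolzano-Weierstrass in the product
    space.\<close>
  have conv: "\<exists>q u' x'. strict_mono q \<and> ((\<lambda>\<nu>. (u \<nu>, x \<nu>)) \<circ> (r \<circ> q)) \<longlonglongrightarrow> (u', x')"
    for r :: "nat \<Rightarrow> nat"
  proof -
    have "bounded (range ((\<lambda>\<nu>. (u \<nu>, x \<nu>)) \<circ> r))"
      using assms(18) by (rule bounded_subset) auto
    then obtain q l where "strict_mono q" "(((\<lambda>\<nu>. (u \<nu>, x \<nu>)) \<circ> r) \<circ> q) \<longlonglongrightarrow> l"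
      using bounded_imp_convergent_subsequence by blast
    then show ?thesis by (cases l) (auto simp: comp_assoc)
  qed
  show ?thesis
  proof (intro conjI allI impI)
    show "(\<lambda>\<nu>. f \<nu> (u \<nu>, x \<nu>)) \<longlonglongrightarrow> (INF y. \<phi> y)"
    \<comment> \<open>The limit point may depend on the subsequence, but the limit of the values
      does not.\<close>
    proof (rule tendsto_if_subseq_tendsto)
      fix r :: "nat \<Rightarrow> nat" assume r: "strict_mono r"
      obtain q u' x' where q: "strict_mono q"
        and l: "((\<lambda>\<nu>. (u \<nu>, x \<nu>)) \<circ> (r \<circ> q)) \<longlonglongrightarrow> (u', x')"
        using conv by blast
      have "((\<lambda>\<nu>. f \<nu> (u \<nu>, x \<nu>)) \<circ> (r \<circ> q)) \<longlonglongrightarrow> (INF y. \<phi> y)"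
        using subseq[OF strict_mono_o[OF r q] _ l] assms(21) by (simp add: o_def)
      with q show "\<exists>q. strict_mono q \<and>
          ((\<lambda>\<nu>. f \<nu> (u \<nu>, x \<nu>)) \<circ> (r \<circ> q)) \<longlonglongrightarrow> (INF y. \<phi> y)"
        by blast
    qed
  next
    show "LimOut (\<lambda>\<nu>. eps_argmin (\<epsilon>s \<nu>) (f \<nu>)) \<subseteq> {0} \<times> argmin \<phi>"
    proof safe
      fix u' x' assume "(u', x') \<in> LimOut (\<lambda>\<nu>. eps_argmin (\<epsilon>s \<nu>) (f \<nu>))"
      then obtain r w where "strict_mono r" "\<And>k. w k \<in> eps_argmin (\<epsilon>s (r k)) (f (r k))"
        "w \<longlonglongrightarrow> (u', x')"
        unfolding LimOut_def by blast
      from subseq[OF this] show "u' = 0" "x' \<in> argmin \<phi>" by auto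
    qed
  next
    fix z assume "cluster_point x z"
    then obtain r where r: "strict_mono r" "(x \<circ> r) \<longlonglongrightarrow> z"
      by (auto simp: cluster_point_def)
    \<comment> \<open>Along \<open>r\<close> only \<open>x\<close> is known to converge; the further
      subsequence makes \<open>u\<close> converge as well and keeps the limit
      \<open>z\<close>.\<close>
    obtain q u' x' where q: "strict_mono q"
      and l: "((\<lambda>\<nu>. (u \<nu>, x \<nu>)) \<circ> (r \<circ> q)) \<longlonglongrightarrow> (u', x')"
      using conv by blast
    have "x' = z"
      using tendsto_snd[OF l] LIMSEQ_subseq_LIMSEQ[OF r(2) q]
      by (auto simp: o_def intro: LIMSEQ_unique)
    moreover have "x' \<in> argmin \<phi>"
      using subseq[OF strict_mono_o[OF r(1) q] _ l] assms(21) by simp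
    ultimately show "z \<in> argmin \<phi>" by simp
  qed
qed

end
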